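(* Let $B\subset\mathbb{R}^3\times[0,2\pi]$ be a loop braid. Then one can construct a time-dependent real analytic vector field $V_t:\mathbb{R}^3\to\mathbb{R}^3$, $t\in\mathbb{R}$, such that (i) $\nabla\cdot V_t=0$ for all $t\in\mathbb{R}$; (ii) $V_t=V_{t+2\pi}$ for all $t\in\mathbb{R}$; (iii) there are closed flow lines of $V_t$ that move as prescribed by $B$ as $t$ varies between $0$ and $2\pi$, i.e. for all $t\in\mathbb{R}$ the field $V_t$ is tangent to $B\cap\left(\mathbb{R}^3\times\{t \bmod 2\pi\}\right)$.
   Context: A loop braid is represented by a loop, parametrised by $t\in[0,2\pi]$, in the configuration space of $n$ disjoint unordered unlinked Euclidean circles in a 3-ball in $\mathbb{R}^3$, each lying in a plane parallel to a given fixed plane (the $xy$-plane). It is regarded as the subset $B\subset\mathbb{R}^3\times[0,2\pi]$ whose slice $B\cap(\mathbb{R}^3\times\{t\})$ is the configuration of circles at time $t$; the configurations at $t=0$ and $t=2\pi$ agree. The slice $B\cap(\mathbb{R}^3\times\{t\})$ is viewed as a subset of $\mathbb{R}^3$ when compared with $V_t$. The divergence $\nabla\cdot V_t$ is taken with respect to the three space variables $x,y,z$. *)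

theory Defs
  imports "HOL-Analysis.Analysis" "HOL-Library.Real_Mod"
begin

section \<open>Vector fields\<close>

text \<open>The monomials are indexed by multi-indices \<open>\<alpha> :: 'n \<Rightarrow> nat\<close>; since they form a countable set
  without a preferred order, convergence of the power series is unconditional summation.\<close>

definition real_analytic_at :: "(real ^ 'n \<Rightarrow> 'b::real_normed_vector) \<Rightarrow> real ^ 'n \<Rightarrow> bool" where
  "real_analytic_at f p \<longleftrightarrow>
     (\<exists>r>0. \<exists>a :: ('n \<Rightarrow> nat) \<Rightarrow> 'b. \<forall>q\<in>ball p r.
        ((\<lambda>\<alpha>. (\<Prod>i\<in>UNIV. (q $ i - p $ i) ^ \<alpha> i) *\<^sub>R a \<alpha>) has_sum f q) UNIV)"

definition real_analytic :: "(real ^ 'n \<Rightarrow> 'b::real_normed_vector) \<Rightarrow> bool" where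
  "real_analytic f \<longleftrightarrow> (\<forall>p. real_analytic_at f p)"

definition divergence :: "(real ^ 'n \<Rightarrow> real ^ 'n) \<Rightarrow> real ^ 'n \<Rightarrow> real" where
  "divergence V p = (\<Sum>i\<in>UNIV. deriv (\<lambda>s. V (p + s *\<^sub>R axis i 1) $ i) 0)"

definition flow_line :: "('a \<Rightarrow> 'a) \<Rightarrow> (real \<Rightarrow> 'a::real_normed_vector) \<Rightarrow> bool" where
  "flow_line V \<phi> \<longleftrightarrow> (\<forall>s. (\<phi> has_vector_derivative V (\<phi> s)) (at s))"

text \<open>Stationary points are periodic too, but they are not closed flow lines; hence the
  requirement that \<open>\<phi>\<close> be non-constant.\<close>

definition closed_flow_line :: "('a \<Rightarrow> 'a) \<Rightarrow> 'a::real_normed_vector set \<Rightarrow> bool" where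
  "closed_flow_line V C \<longleftrightarrow>
     (\<exists>\<phi> T. flow_line V \<phi> \<and> 0 < T \<and> (\<forall>s. \<phi> (s + T) = \<phi> s) \<and> (\<exists>s. \<phi> s \<noteq> \<phi> 0) \<and> range \<phi> = C)"

text \<open>Tangent vectors of \<open>S\<close> at \<open>p\<close> are the velocities at \<open>p\<close> of curves in \<open>S\<close>.\<close>

definition tangent_to :: "('a \<Rightarrow> 'a) \<Rightarrow> 'a::real_normed_vector set \<Rightarrow> bool" where
  "tangent_to V S \<longleftrightarrow>
     (\<forall>p\<in>S. \<exists>c. (\<forall>s. c s \<in> S) \<and> c 0 = p \<and> (c has_vector_derivative V p) (at 0))"


section \<open>Configuration spaces of horizontal circles\<close>

definition circle :: "(real ^ 3) \<times> real \<Rightarrow> (real ^ 3) set" where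
  "circle = (\<lambda>(a, r). {p. p $ 3 = a $ 3 \<and> dist p a = r})"

text \<open>Trivial link: the components bound pairwise disjoint embedded discs. Disjoint circles in
  parallel planes always satisfy this, so the condition does not cut down the space below; it is
  kept because it is part of the usual definition.\<close>

definition unlinked :: "(real ^ 3) set set \<Rightarrow> bool" where
  "unlinked L \<longleftrightarrow>
     (\<exists>h :: (real ^ 3) set \<Rightarrow> complex \<Rightarrow> real ^ 3.
        (\<forall>C\<in>L. continuous_on (cball 0 1) (h C) \<and> inj_on (h C) (cball 0 1) \<and> h C ` sphere 0 1 = C) \<and>
        disjoint_family_on (\<lambda>C. h C ` cball 0 1) L)"

text \<open>Ordered configurations are \<open>n\<close>-tuples of pairs (centre, radius), topologised as a subspace
  of the product; extensionality makes the tuple determined by its first \<open>n\<close> entries.\<close>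

definition ordered_configs :: "nat \<Rightarrow> (real ^ 3) set \<Rightarrow> (nat \<Rightarrow> (real ^ 3) \<times> real) set" where
  "ordered_configs n D =
     {c \<in> extensional {..<n}.
        (\<forall>i<n. 0 < snd (c i) \<and> circle (c i) \<subseteq> D) \<and>
        disjoint_family_on (\<lambda>i. circle (c i)) {..<n} \<and>
        unlinked ((\<lambda>i. circle (c i)) ` {..<n})}"

definition ordered_config_space :: "nat \<Rightarrow> (real ^ 3) set \<Rightarrow> (nat \<Rightarrow> (real ^ 3) \<times> real) topology" where
  "ordered_config_space n D =
     subtopology (product_topology (\<lambda>_. euclidean) {..<n}) (ordered_configs n D)"

definition forget_order :: "nat \<Rightarrow> (nat \<Rightarrow> (real ^ 3) \<times> real) \<Rightarrow> (real ^ 3) set set" where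
  "forget_order n c = (\<lambda>i. circle (c i)) ` {..<n}"

definition quotient_topology :: "'a topology \<Rightarrow> ('a \<Rightarrow> 'b) \<Rightarrow> 'b topology" where
  "quotient_topology X f =
     topology (\<lambda>U. U \<subseteq> f ` topspace X \<and> openin X {x \<in> topspace X. f x \<in> U})"

lemma openin_quotient_topology:
  "openin (quotient_topology X f) U \<longleftrightarrow>
     U \<subseteq> f ` topspace X \<and> openin X {x \<in> topspace X. f x \<in> U}"
proof -
  have "istopology (\<lambda>U. U \<subseteq> f ` topspace X \<and> openin X {x \<in> topspace X. f x \<in> U})"
    unfolding istopology_def
  proof (intro conjI allI impI; (elim conjE)?)
    fix S T
    assume "openin X {x \<in> topspace X. f x \<in> S}" "openin X {x \<in> topspace X. f x \<in> T}"
    then have "openin X ({x \<in> topspace X. f x \<in> S} \<inter> {x \<in> topspace X. f x \<in> T})"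
      by (rule openin_Int)
    also have "\<dots> = {x \<in> topspace X. f x \<in> S \<inter> T}" by auto
    finally show "openin X {x \<in> topspace X. f x \<in> S \<inter> T}" .
  next
    fix K
    assume "\<forall>U\<in>K. U \<subseteq> f ` topspace X \<and> openin X {x \<in> topspace X. f x \<in> U}"
    then have "openin X (\<Union>U\<in>K. {x \<in> topspace X. f x \<in> U})" by blast
    also have "(\<Union>U\<in>K. {x \<in> topspace X. f x \<in> U}) = {x \<in> topspace X. f x \<in> \<Union>K}" by auto
    finally show "openin X {x \<in> topspace X. f x \<in> \<Union>K}" .
  qed blast+
  then show ?thesis
    by (simp add: quotient_topology_def topology_inverse')
qed

lemma topspace_quotient_topology: "topspace (quotient_topology X f) = f ` topspace X"
proof
  have "{x \<in> topspace X. f x \<in> f ` topspace X} = topspace X" by auto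
  then have "openin (quotient_topology X f) (f ` topspace X)"
    by (simp add: openin_quotient_topology)
  then show "f ` topspace X \<subseteq> topspace (quotient_topology X f)" by (rule openin_subset)
  show "topspace (quotient_topology X f) \<subseteq> f ` topspace X"
    by (metis openin_quotient_topology openin_topspace)
qed

lemma quotient_map_quotient_topology: "quotient_map X (quotient_topology X f) f"
  by (auto simp: quotient_map_def topspace_quotient_topology openin_quotient_topology)

definition config_space :: "nat \<Rightarrow> (real ^ 3) set \<Rightarrow> (real ^ 3) set set topology" where
  "config_space n D = quotient_topology (ordered_config_space n D) (forget_order n)"


section \<open>Loop braids\<close>

definition slice :: "('a \<times> real) set \<Rightarrow> real \<Rightarrow> 'a set" where
  "slice B t = {p. (p, t) \<in> B}"

definition loop_braid :: "nat \<Rightarrow> ((real ^ 3) \<times> real) set \<Rightarrow> bool" where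
  "loop_braid n B \<longleftrightarrow>
     (\<exists>a R \<gamma>. 0 < R \<and>
        continuous_map (top_of_set {0..2 * pi}) (config_space n (cball a R)) \<gamma> \<and>
        \<gamma> 0 = \<gamma> (2 * pi) \<and>
        B = {(p, t). t \<in> {0..2 * pi} \<and> p \<in> \<Union>(\<gamma> t)})"

end

theory Submission
  imports Defs
begin

text \<open>
  A field of the form \<open>(- \<partial>\<psi>/\<partial>y, \<partial>\<psi>/\<partial>x, 0)\<close> is divergence-free for every smooth stream function \<open>\<psi>\<close>, and it
  is tangent to a horizontal circle as soon as \<open>\<psi>\<close> is constant on it. Since the circles of a
  configuration may have intersecting projections to the plane, \<open>\<psi>\<close> has to depend on the height as
  well. For a circle \<open>k\<close> with centre \<open>(a, b, c)\<close> and radius \<open>r\<close> let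
  \<open>F\<^sub>k = (x - a)\<^sup>2 + (y - b)\<^sup>2 - r\<^sup>2\<close> and \<open>G\<^sub>k = F\<^sub>k\<^sup>2 + (z - c)\<^sup>2\<close>, and put
  \<open>\<psi> = (\<Sum>k. F\<^sub>k * (\<Prod>j\<noteq>k. G\<^sub>j))\<close>.
  The polynomial \<open>G\<^sub>k\<close> is nonnegative and vanishes exactly on the circle \<open>k\<close>, to second order. On that
  circle all summands but that of \<open>k\<close> therefore vanish with their derivatives, and the field is
  \<open>2 * (\<Prod>j\<noteq>k. G\<^sub>j)\<close> times the rotation \<open>(- (y - b), x - a, 0)\<close>. The factor is positive because the
  circles are disjoint; so the circle is a closed orbit: its angle satisfies
  a scalar autonomous equation with positive periodic right-hand side, which is solved by separation
  of variables (\<open>closed_flow_line_stream_field\<close>, \<open>periodic_autonomous_ode\<close>).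

  For a fixed time the field is polynomial, hence analytic. Its coefficients are continuous
  functions of the ordered configuration, so the field is continuous in the configuration and the
  point; the definition of \<open>\<psi>\<close> is symmetric in the circles, so this passes to unordered
  configurations (\<open>continuous_map_config_space_field\<close>). Composing with the given loop of
  configurations and extending periodically gives the time-dependent field.
\<close>

section \<open>Polynomials with continuous coefficients\<close>

definition dir_deriv :: "real ^ 'n \<Rightarrow> (real ^ 'n \<Rightarrow> real) \<Rightarrow> real ^ 'n \<Rightarrow> real" where
  "dir_deriv v f p = deriv (\<lambda>s. f (p + s *\<^sub>R v)) 0"

text \<open>Polynomials in the coordinates of \<open>p\<close> whose coefficients are continuous functions on \<open>X\<close>. Products
  are generated by one coordinate at a time, because inductions on the generation (analyticity above
  all) then need to treat a factor \<open>p $ i\<close> only; closure under arbitrary products is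
  derived below.\<close>

inductive polynomial_family :: "'x topology \<Rightarrow> ('x \<Rightarrow> real ^ 'n \<Rightarrow> real) \<Rightarrow> bool" for X where
  coefficient: "continuous_map X euclideanreal g \<Longrightarrow> polynomial_family X (\<lambda>x p. g x)"
| add: "polynomial_family X f \<Longrightarrow> polynomial_family X g \<Longrightarrow> polynomial_family X (\<lambda>x p. f x p + g x p)"
| times_coordinate: "polynomial_family X f \<Longrightarrow> polynomial_family X (\<lambda>x p. p $ i * f x p)"

lemma polynomial_family_coordinate: "polynomial_family X (\<lambda>x p. p $ i)"
  using polynomial_family.times_coordinate[OF polynomial_family.coefficient[of X "\<lambda>_. 1"], of i] by simp

lemma polynomial_family_scale:
  assumes "polynomial_family X f" and g: "continuous_map X euclideanreal g"
  shows "polynomial_family X (\<lambda>x p. g x * f x p)"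
  using assms(1)
proof induction
  case (coefficient h)
  then show ?case
    using g by (intro polynomial_family.coefficient continuous_map_real_mult)
next
  case (add h k)
  then show ?case
    by (simp add: distrib_left polynomial_family.add)
next
  case (times_coordinate h i)
  then show ?case
    using polynomial_family.times_coordinate[of X "\<lambda>x p. g x * h x p" i]
    by (simp add: mult.left_commute)
qed

lemma polynomial_family_mult:
  assumes "polynomial_family X f" and g: "polynomial_family X g"
  shows "polynomial_family X (\<lambda>x p. f x p * g x p)"
  using assms(1)
proof induction
  case (coefficient h)
  then show ?case
    using g by (rule polynomial_family_scale[rotated])
next
  case (add h k)
  then show ?case
    by (simp add: distrib_right polynomial_family.add)
next
  case (times_coordinate h i)
  then show ?case
    using polynomial_family.times_coordinate[of X "\<lambda>x p. h x p * g x p" i]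
    by (simp add: mult.assoc)
qed

lemma polynomial_family_const: "polynomial_family X (\<lambda>x p. c)"
  by (rule polynomial_family.coefficient) simp

lemma polynomial_family_diff:
  assumes "polynomial_family X f" "polynomial_family X g"
  shows "polynomial_family X (\<lambda>x p. f x p - g x p)"
  using polynomial_family.add[OF assms(1) polynomial_family_mult[OF polynomial_family_const[of X "-1"] assms(2)]]
  by simp

lemma polynomial_family_power:
  assumes "polynomial_family X f"
  shows "polynomial_family X (\<lambda>x p. f x p ^ m)"
  by (induction m) (simp_all add: polynomial_family_const polynomial_family_mult assms)

lemma polynomial_family_sum:
  assumes "\<And>i. i \<in> I \<Longrightarrow> polynomial_family X (f i)"
  shows "polynomial_family X (\<lambda>x p. \<Sum>i\<in>I. f i x p)"
  using assms
  by (induction I rule: infinite_finite_induct)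
    (simp_all add: polynomial_family_const polynomial_family.add)

lemma polynomial_family_prod:
  assumes "\<And>i. i \<in> I \<Longrightarrow> polynomial_family X (f i)"
  shows "polynomial_family X (\<lambda>x p. \<Prod>i\<in>I. f i x p)"
  using assms
  by (induction I rule: infinite_finite_induct)
    (simp_all add: polynomial_family_const polynomial_family_mult)

text \<open>Fixing \<open>x\<close> leaves a polynomial, but the family is continuous in both arguments jointly: this
  is what makes the field, later a derivative of such a family, continuous in time and space.\<close>

lemma polynomial_family_continuous:
  assumes "polynomial_family X f"
  shows "continuous_map (prod_topology X euclidean) euclideanreal (\<lambda>(x, p). f x p)"
  using assms
proof induction
  case (coefficient g)
  then show ?case
    by (simp add: case_prod_unfold continuous_map_of_fst[unfolded o_def])
next
  case (add f g)
  then show ?case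
    unfolding case_prod_unfold by (intro continuous_map_add)
next
  case (times_coordinate f i)
  have "continuous_map euclidean euclideanreal (\<lambda>p :: real ^ 'b. p $ i)"
    by (simp add: continuous_on_component)
  then have "continuous_map (prod_topology X euclidean) euclideanreal (\<lambda>z. snd z $ i)"
    by (rule continuous_map_compose[OF continuous_map_snd, unfolded o_def])
  with times_coordinate show ?case
    unfolding case_prod_unfold by (intro continuous_map_real_mult)
qed

lemma dir_deriv_add:
  assumes "(\<lambda>s. f (p + s *\<^sub>R v)) field_differentiable at 0" "(\<lambda>s. g (p + s *\<^sub>R v)) field_differentiable at 0"
  shows "dir_deriv v (\<lambda>p. f p + g p) p = dir_deriv v f p + dir_deriv v g p"
  using assms by (simp add: dir_deriv_def)

lemma dir_deriv_mult:
  assumes "(\<lambda>s. f (p + s *\<^sub>R v)) field_differentiable at 0" "(\<lambda>s. g (p + s *\<^sub>R v)) field_differentiable at 0"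
  shows "dir_deriv v (\<lambda>p. f p * g p) p = dir_deriv v f p * g p + f p * dir_deriv v g p"
  using assms by (simp add: dir_deriv_def)

lemma has_derivative_coordinate:
  "((\<lambda>s. (p + s *\<^sub>R v) $ i) has_field_derivative v $ i) (at 0)"
  by (auto intro!: derivative_eq_intros)

lemma dir_deriv_coordinate: "dir_deriv v (\<lambda>p. p $ i) p = v $ i"
  unfolding dir_deriv_def by (rule DERIV_imp_deriv[OF has_derivative_coordinate])

lemma polynomial_family_differentiable:
  assumes "polynomial_family X f"
  shows "(\<lambda>s. f x (p + s *\<^sub>R v)) field_differentiable at 0"
  using assms
proof induction
  case (times_coordinate f i)
  moreover have "(\<lambda>s. (p + s *\<^sub>R v) $ i) field_differentiable at 0"
    using has_derivative_coordinate field_differentiable_def by blast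
  ultimately show ?case by (simp add: field_differentiable_mult)
qed (simp_all add: field_differentiable_add)

lemma dir_deriv_times_coordinate:
  assumes "polynomial_family X f"
  shows "dir_deriv v (\<lambda>p. p $ i * f x p) p = v $ i * f x p + p $ i * dir_deriv v (f x) p"
  using dir_deriv_mult[OF polynomial_family_differentiable[OF polynomial_family_coordinate]
      polynomial_family_differentiable[OF assms]]
  by (simp add: dir_deriv_coordinate)

lemma dir_deriv_const [simp]: "dir_deriv v (\<lambda>p. c) p = 0"
  by (simp add: dir_deriv_def)

text \<open>Differentiating in space keeps coefficients that are continuous on \<open>X\<close>, by the Leibniz rule. Hence
  the derivative is jointly continuous as well, without any formula for it.\<close>

lemma polynomial_family_dir_deriv:
  assumes "polynomial_family X f"
  shows "polynomial_family X (\<lambda>x. dir_deriv v (f x))"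
  using assms
proof induction
  case (coefficient g)
  have "(\<lambda>x. dir_deriv v (\<lambda>p. g x)) = (\<lambda>x p. 0)"
    by (simp add: fun_eq_iff)
  then show ?case by (simp add: polynomial_family_const)
next
  case (add f g)
  have "(\<lambda>x. dir_deriv v (\<lambda>p. f x p + g x p)) = (\<lambda>x p. dir_deriv v (f x) p + dir_deriv v (g x) p)"
    using add.hyps by (simp add: fun_eq_iff dir_deriv_add polynomial_family_differentiable)
  then show ?case using add.IH by (simp add: polynomial_family.add)
next
  case (times_coordinate f i)
  have "(\<lambda>x. dir_deriv v (\<lambda>p. p $ i * f x p)) =
      (\<lambda>x p. v $ i * f x p + p $ i * dir_deriv v (f x) p)"
    using times_coordinate.hyps by (simp add: fun_eq_iff dir_deriv_times_coordinate)
  moreover have "polynomial_family X (\<lambda>x p. v $ i * f x p)"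
    using times_coordinate.hyps by (rule polynomial_family_scale) simp
  ultimately show ?case
    using times_coordinate.IH by (simp add: polynomial_family.add polynomial_family.times_coordinate)
qed

text \<open>Schwarz's theorem for polynomials: for \<open>p $ i * f\<close> the second derivative is
  \<open>v $ i * D\<^sub>w f + w $ i * D\<^sub>v f + p $ i * D\<^sub>v D\<^sub>w f\<close>, symmetric in \<open>v\<close> and \<open>w\<close> as soon as
  \<open>D\<^sub>v D\<^sub>w f\<close> is.\<close>

lemma dir_deriv_commute:
  assumes "polynomial_family X f"
  shows "dir_deriv v (dir_deriv w (f x)) p = dir_deriv w (dir_deriv v (f x)) p"
  using assms
proof (induction arbitrary: p)
  case (coefficient g)
  have "dir_deriv u (\<lambda>p. g x) = (\<lambda>p. 0)" for u :: "real ^ 'b"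
    by (simp add: fun_eq_iff)
  then show ?case by simp
next
  case (add f g)
  have "dir_deriv u (\<lambda>p. f x p + g x p) = (\<lambda>p. dir_deriv u (f x) p + dir_deriv u (g x) p)" for u
    using add.hyps by (simp add: fun_eq_iff dir_deriv_add polynomial_family_differentiable)
  then show ?case
    using add.hyps add.IH
    by (simp add: dir_deriv_add polynomial_family_differentiable[OF polynomial_family_dir_deriv])
next
  case (times_coordinate f i)
  have *: "dir_deriv u (\<lambda>p. p $ i * f x p) = (\<lambda>p. u $ i * f x p + p $ i * dir_deriv u (f x) p)" for u
    using times_coordinate.hyps by (simp add: fun_eq_iff dir_deriv_times_coordinate)
  have "dir_deriv u (\<lambda>p. u' $ i * f x p + p $ i * dir_deriv u' (f x) p) p =
      u' $ i * dir_deriv u (f x) p + u $ i * dir_deriv u' (f x) p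
      + p $ i * dir_deriv u (dir_deriv u' (f x)) p" for u u'
  proof -
    have 1: "polynomial_family X (\<lambda>x p. u' $ i * f x p)"
      using times_coordinate.hyps by (rule polynomial_family_scale) simp
    have 2: "polynomial_family X (\<lambda>x. dir_deriv u' (f x))"
      using times_coordinate.hyps by (rule polynomial_family_dir_deriv)
    have "dir_deriv u (\<lambda>p. u' $ i * f x p) p = u' $ i * dir_deriv u (f x) p"
      using polynomial_family_differentiable[OF times_coordinate.hyps, where x = x and p = p and v = u]
      by (simp add: dir_deriv_def)
    then show ?thesis
      using polynomial_family_differentiable[OF 1, where x = x and p = p and v = u]
        polynomial_family_differentiable[OF polynomial_family.times_coordinate[OF 2, of i], where x = x and p = p and v = u]
      by (simp add: dir_deriv_add dir_deriv_times_coordinate[OF 2])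
  qed
  from this[of v w] this[of w v] times_coordinate.IH show ?case
    by (simp add: *)
qed

lemma real_analytic_at_add:
  assumes "real_analytic_at f p" "real_analytic_at g p"
  shows "real_analytic_at (\<lambda>q. f q + g q) p"
proof -
  obtain r a where "r > 0" and f: "\<forall>q\<in>ball p r.
        ((\<lambda>\<alpha>. (\<Prod>i\<in>UNIV. (q $ i - p $ i) ^ \<alpha> i) *\<^sub>R a \<alpha>) has_sum f q) UNIV"
    using assms(1) unfolding real_analytic_at_def by blast
  obtain r' a' where "r' > 0" and g: "\<forall>q\<in>ball p r'.
        ((\<lambda>\<alpha>. (\<Prod>i\<in>UNIV. (q $ i - p $ i) ^ \<alpha> i) *\<^sub>R a' \<alpha>) has_sum g q) UNIV"
    using assms(2) unfolding real_analytic_at_def by blast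
  show ?thesis
    unfolding real_analytic_at_def
  proof (intro exI[of _ "min r r'"] exI[of _ "\<lambda>\<alpha>. a \<alpha> + a' \<alpha>"] conjI ballI)
    fix q assume "q \<in> ball p (min r r')"
    then show "((\<lambda>\<alpha>. (\<Prod>i\<in>UNIV. (q $ i - p $ i) ^ \<alpha> i) *\<^sub>R (a \<alpha> + a' \<alpha>)) has_sum f q + g q) UNIV"
      using f g by (simp add: scaleR_right_distrib has_sum_add)
  qed (use \<open>r > 0\<close> \<open>r' > 0\<close> in auto)
qed

lemma real_analytic_at_scaleR:
  assumes "real_analytic_at f p"
  shows "real_analytic_at (\<lambda>q. f q *\<^sub>R b) p"
proof -
  obtain r a where "r > 0" and f: "\<forall>q\<in>ball p r.
        ((\<lambda>\<alpha>. (\<Prod>i\<in>UNIV. (q $ i - p $ i) ^ \<alpha> i) *\<^sub>R a \<alpha>) has_sum f q) UNIV"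
    using assms unfolding real_analytic_at_def by blast
  show ?thesis
    unfolding real_analytic_at_def
  proof (intro exI[of _ r] exI[of _ "\<lambda>\<alpha>. a \<alpha> *\<^sub>R b"] conjI ballI)
    fix q assume "q \<in> ball p r"
    with f have "((\<lambda>\<alpha>. (\<Prod>i\<in>UNIV. (q $ i - p $ i) ^ \<alpha> i) *\<^sub>R a \<alpha>) has_sum f q) UNIV"
      by blast
    from has_sum_bounded_linear[OF bounded_linear_scaleR_left this, of b]
    show "((\<lambda>\<alpha>. (\<Prod>i\<in>UNIV. (q $ i - p $ i) ^ \<alpha> i) *\<^sub>R a \<alpha> *\<^sub>R b) has_sum f q *\<^sub>R b) UNIV"
      by simp
  qed (use \<open>r > 0\<close> in auto)
qed

lemma real_analytic_at_monomial:
  "real_analytic_at (\<lambda>q. (\<Prod>i\<in>UNIV. (q $ i - p $ i) ^ \<alpha> i) * c) p" for c :: real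
  unfolding real_analytic_at_def
proof (intro exI[of _ 1] exI[of _ "\<lambda>\<beta>. if \<beta> = \<alpha> then c else 0"] conjI ballI)
  fix q assume "q \<in> ball p 1"
  show "((\<lambda>\<beta>. (\<Prod>i\<in>UNIV. (q $ i - p $ i) ^ \<beta> i) *\<^sub>R (if \<beta> = \<alpha> then c else 0)) has_sum
      (\<Prod>i\<in>UNIV. (q $ i - p $ i) ^ \<alpha> i) * c) UNIV"
    by (rule has_sum_finite_neutralI[of "{\<alpha>}"]) auto
qed simp

lemma monomial_times_coordinate:
  fixes q p :: "real ^ 'n"
  shows "(\<Prod>i\<in>UNIV. (q $ i - p $ i) ^ \<alpha> i) * q $ k =
    (\<Prod>i\<in>UNIV. (q $ i - p $ i) ^ (\<alpha>(k := Suc (\<alpha> k))) i) + (\<Prod>i\<in>UNIV. (q $ i - p $ i) ^ \<alpha> i) * p $ k"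
proof -
  have "(\<Prod>i\<in>UNIV - {k}. (q $ i - p $ i) ^ (\<alpha>(k := Suc (\<alpha> k))) i) =
      (\<Prod>i\<in>UNIV - {k}. (q $ i - p $ i) ^ \<alpha> i)"
    by (rule prod.cong) auto
  then show ?thesis
    by (simp add: prod.remove[of UNIV k] algebra_simps)
qed

text \<open>A polynomial is a finite combination of the monomials centred at \<open>p\<close>. The re-expansion is avoided by
  proving that \<open>f\<close> times every centred monomial is analytic: a factor \<open>q $ k\<close> of \<open>f\<close> is
  \<open>(q $ k - p $ k) + p $ k\<close>, and its first part is absorbed by the monomial.\<close>

lemma polynomial_family_real_analytic_at:
  fixes f :: "'x \<Rightarrow> real ^ 'n \<Rightarrow> real"
  assumes "polynomial_family X f"
  shows "real_analytic_at (f x) p"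
proof -
  have "real_analytic_at (\<lambda>q. (\<Prod>i\<in>UNIV. (q $ i - p $ i) ^ \<alpha> i) * f x q) p" for \<alpha>
    using assms
  proof (induction arbitrary: \<alpha>)
    case (coefficient g)
    show ?case using real_analytic_at_monomial[of p \<alpha> "g x"] by simp
  next
    case (add f g)
    then show ?case by (simp add: distrib_left real_analytic_at_add)
  next
    case (times_coordinate f k)
    let ?m = "\<lambda>\<alpha> q. \<Prod>i\<in>UNIV. (q $ i - p $ i) ^ \<alpha> i"
    have "(\<lambda>q. ?m \<alpha> q * (q $ k * f x q)) =
        (\<lambda>q. ?m (\<alpha>(k := Suc (\<alpha> k))) q * f x q + (?m \<alpha> q * f x q) *\<^sub>R p $ k)"
      by (auto simp: fun_eq_iff mult.assoc[symmetric] monomial_times_coordinate distrib_right)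
    then show ?case
      by (simp only: real_analytic_at_add real_analytic_at_scaleR times_coordinate.IH)
  qed
  from this[of "\<lambda>_. 0"] show ?thesis by simp
qed


section \<open>Fields tangent to a round circle\<close>

definition circle_point :: "(real ^ 3) \<times> real \<Rightarrow> real \<Rightarrow> real ^ 3" where
  "circle_point = (\<lambda>(a, r) \<theta>. a + r *\<^sub>R vector [cos \<theta>, sin \<theta>, 0])"

lemma circle_point_nth [simp]:
  "circle_point (a, r) \<theta> $ 1 = a $ 1 + r * cos \<theta>"
  "circle_point (a, r) \<theta> $ 2 = a $ 2 + r * sin \<theta>"
  "circle_point (a, r) \<theta> $ 3 = a $ 3"
  by (simp_all add: circle_point_def)

lemma dist_vec3: "dist p q = sqrt ((p $ 1 - q $ 1)\<^sup>2 + (p $ 2 - q $ 2)\<^sup>2 + (p $ 3 - q $ 3)\<^sup>2)"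
  for p q :: "real ^ 3"
  by (simp add: dist_vec_def L2_set_def sum_3 dist_real_def)

lemma mem_circle_iff:
  assumes "r \<ge> 0"
  shows "p \<in> circle (a, r) \<longleftrightarrow> p $ 3 = a $ 3 \<and> (p $ 1 - a $ 1)\<^sup>2 + (p $ 2 - a $ 2)\<^sup>2 = r\<^sup>2"
  using assms by (auto simp: circle_def dist_vec3 real_sqrt_unique)

lemma range_circle_point:
  assumes "r > 0"
  shows "range (circle_point (a, r)) = circle (a, r)"
proof
  show "range (circle_point (a, r)) \<subseteq> circle (a, r)"
    using assms
    by (auto simp: mem_circle_iff power_mult_distrib simp flip: distrib_left)
  show "circle (a, r) \<subseteq> range (circle_point (a, r))"
  proof
    fix p assume "p \<in> circle (a, r)"
    then have p: "p $ 3 = a $ 3" "(p $ 1 - a $ 1)\<^sup>2 + (p $ 2 - a $ 2)\<^sup>2 = r\<^sup>2"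
      using assms by (auto simp: mem_circle_iff)
    then have "((p $ 1 - a $ 1) / r)\<^sup>2 + ((p $ 2 - a $ 2) / r)\<^sup>2 = 1"
      using assms by (simp add: power_divide flip: add_divide_distrib)
    then obtain \<theta> where "(p $ 1 - a $ 1) / r = cos \<theta>" "(p $ 2 - a $ 2) / r = sin \<theta>"
      using sincos_total_2pi by metis
    then have "p = circle_point (a, r) \<theta>"
      using assms p by (simp add: vec_eq_iff forall_3 field_simps)
    then show "p \<in> range (circle_point (a, r))" by blast
  qed
qed

lemma has_vector_derivative_circle_point:
  assumes "(H has_real_derivative h) (at s)"
  shows "((\<lambda>s. circle_point (a, r) (H s)) has_vector_derivative
    h *\<^sub>R vector [- (r * sin (H s)), r * cos (H s), 0]) (at s)"
proof -
  have *: "(vector [x, y, 0] :: real ^ 3) = x *\<^sub>R axis 1 1 + y *\<^sub>R axis 2 1" for x y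
    by (simp add: vec_eq_iff forall_3 axis_def)
  show ?thesis
    unfolding circle_point_def *
    by (auto intro!: derivative_eq_intros assms[THEN has_field_derivative_subset] assms
        simp: algebra_simps)
qed

lemma continuous_on_circle_point: "continuous_on UNIV (circle_point (a, r))"
  using has_vector_derivative_circle_point[OF DERIV_ident]
  by (meson continuous_at_imp_continuous_on has_vector_derivative_continuous)

lemma connected_circle:
  assumes "r > 0"
  shows "connected (circle (a, r))"
  using connected_continuous_image[OF continuous_on_circle_point[of a r] connected_UNIV]
  by (simp add: range_circle_point[OF assms])

lemma closed_circle: "closed (circle k)"
proof (cases k)
  case (Pair a r)
  have "closed {p :: real ^ 3. p $ 3 = a $ 3 \<and> dist p a = r}"
    by (intro closed_Collect_conj closed_Collect_eq continuous_intros)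
  then show ?thesis by (simp add: Pair circle_def)
qed

text \<open>Separation of variables: an antiderivative \<open>h\<close> of \<open>1 / g\<close> is an increasing bijection of the line,
  and its inverse solves the equation. As \<open>g\<close> has period \<open>c\<close>, \<open>h\<close> grows by one and the same \<open>T\<close> over
  each interval of length \<open>c\<close>; so the solution advances by one period of \<open>g\<close> in time \<open>T\<close>.\<close>

lemma periodic_autonomous_ode:
  fixes g :: "real \<Rightarrow> real"
  assumes cont: "continuous_on UNIV g" and pos: "\<And>x. g x > 0"
    and per: "\<And>x. g (x + c) = g x" and "c > 0"
  obtains H T where "T > 0" "\<And>s. (H has_real_derivative g (H s)) (at s)"
    "\<And>s. H (s + T) = H s + c" "surj H"
proof -
  have "isCont (\<lambda>x. 1 / g x) x" for x
    using cont pos[of x] by (intro continuous_intros) (auto simp: continuous_on_eq_continuous_at)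
  then obtain h where h: "\<And>x. (h has_real_derivative 1 / g x) (at x)"
    using einterval_antiderivative[of "-\<infinity>" \<infinity> "\<lambda>x. 1 / g x"]
    by (auto simp: has_real_derivative_iff_has_vector_derivative)
  have mono: "h x < h y" if "x < y" for x y
    by (rule DERIV_pos_imp_increasing[OF that]) (use h pos in \<open>auto intro!: exI[of _ "1 / g _"]\<close>)
  define T where "T = h c - h 0"
  have "T > 0"
    using mono[OF \<open>c > 0\<close>] by (simp add: T_def)
  have h_per: "h (x + c) = h x + T" for x
  proof -
    have "((\<lambda>x. h (x + c) - h x) has_real_derivative 0) (at y)" for y
      using DERIV_diff[OF DERIV_shift[THEN iffD1, OF h] h, of c y] by (simp add: per)
    then have "h (x + c) - h x = h (0 + c) - h 0"
      using DERIV_isconst_all by blast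
    then show ?thesis by (simp add: T_def)
  qed
  \<comment> \<open>Growth by multiples of \<open>T\<close> makes \<open>h\<close> unbounded on both sides, hence onto.\<close>
  have up: "h (real m * c) = h 0 + real m * T" for m
  proof (induction m)
    case (Suc m)
    then show ?case
      using h_per[of "real m * c"] by (simp add: algebra_simps)
  qed simp
  have down: "h (- (real m * c)) = h 0 - real m * T" for m
  proof (induction m)
    case (Suc m)
    then show ?case
      using h_per[of "- (real (Suc m) * c)"] by (simp add: algebra_simps)
  qed simp
  have h_cont: "isCont h x" for x
    using h by (rule DERIV_isCont)
  have "surj h"
    unfolding surj_def
  proof
    fix y
    obtain m where "real m * T > \<bar>y - h 0\<bar>"
      using reals_Archimedean3[OF \<open>T > 0\<close>] by blast
    then have "h (- (real m * c)) \<le> y" "y \<le> h (real m * c)"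
      unfolding up down by linarith+
    moreover have "continuous_on {- (real m * c)..real m * c} h"
      using h_cont by (simp add: continuous_at_imp_continuous_on)
    ultimately have "\<exists>x. h x = y"
      using IVT'[of h "- (real m * c)" y "real m * c"] \<open>c > 0\<close> by auto
    then show "\<exists>x. y = h x" by metis
  qed
  have "inj h"
    by (metis injI linorder_neqE_linordered_idom mono less_irrefl)
  define H where "H = inv h"
  have hH: "h (H s) = s" and Hh: "H (h x) = x" for s x
    using \<open>surj h\<close> \<open>inj h\<close> by (simp_all add: H_def surj_f_inv_f)
  have "(H has_real_derivative g (H s)) (at s)" for s
  proof -
    have "isCont H (h (H s))"
      by (rule isCont_inverse_function[of 1]) (auto simp: Hh h_cont)
    then have "(H has_real_derivative inverse (1 / g (H s))) (at s)"
      using pos[of "H s"]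
      by (intro DERIV_inverse_function[where f = h and a = "s - 1" and b = "s + 1"])
        (auto simp: hH h)
    then show ?thesis by simp
  qed
  moreover have "H (s + T) = H s + c" for s
    by (metis h_per hH Hh)
  moreover have "surj H"
    by (rule surjI) (rule Hh)
  ultimately show ?thesis
    using that \<open>T > 0\<close> by blast
qed

text \<open>On the circle the field is a positive multiple of the rotation field about its axis, so the
  angle obeys \<open>\<theta>' = g (circle_point (a, r) \<theta>)\<close>, with a positive \<open>2\<pi>\<close>-periodic right-hand side. The
  multiple may vary along the circle, hence the detour through the scalar equation.\<close>

lemma closed_flow_line_circle:
  assumes "r > 0" and cont: "continuous_on (circle (a, r)) g"
    and pos: "\<And>p. p \<in> circle (a, r) \<Longrightarrow> g p > 0"
    and V: "\<And>p. p \<in> circle (a, r) \<Longrightarrow> V p = g p *\<^sub>R vector [- (p $ 2 - a $ 2), p $ 1 - a $ 1, 0]"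
  shows "closed_flow_line V (circle (a, r))"
proof -
  let ?c = "circle_point (a, r)"
  have c: "?c \<theta> \<in> circle (a, r)" for \<theta>
    using range_circle_point[OF \<open>r > 0\<close>] by blast
  have c_per: "?c (\<theta> + 2 * pi) = ?c \<theta>" for \<theta>
    by (simp add: circle_point_def)
  have cont_c: "continuous_on UNIV (\<lambda>\<theta>. g (?c \<theta>))"
    using continuous_on_compose2[OF cont continuous_on_circle_point] c by blast
  obtain H T where "T > 0" and H: "\<And>s. (H has_real_derivative g (?c (H s))) (at s)"
    and per: "\<And>s. H (s + T) = H s + 2 * pi" and "surj H"
    by (rule periodic_autonomous_ode[OF cont_c pos[OF c], of "2 * pi"])
      (auto simp only: c_per pi_gt_zero mult_pos_pos zero_less_numeral)
  have range: "range (\<lambda>s. ?c (H s)) = circle (a, r)"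
    using \<open>surj H\<close> range_circle_point[OF \<open>r > 0\<close>] by (metis image_image)
  have "flow_line V (\<lambda>s. ?c (H s))"
    unfolding flow_line_def
    using has_vector_derivative_circle_point[OF H] by (simp add: V[OF c])
  moreover have "\<exists>s. ?c (H s) \<noteq> ?c (H 0)"
  proof (rule ccontr)
    \<comment> \<open>The angles \<open>0\<close> and \<open>\<pi>\<close> are both reached, and they give antipodal points.\<close>
    assume "\<nexists>s. ?c (H s) \<noteq> ?c (H 0)"
    then have "?c \<theta> = ?c (H 0)" for \<theta>
      using \<open>surj H\<close> by (metis surjD)
    then have "?c 0 $ 1 = ?c pi $ 1" by metis
    then show False using \<open>r > 0\<close> by simp
  qed
  ultimately show ?thesis
    unfolding closed_flow_line_def
    using \<open>T > 0\<close> range per c_per by (intro exI[of _ "\<lambda>s. ?c (H s)"] exI[of _ T]) simp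
qed

lemma closed_flow_line_imp_tangent_to:
  assumes "closed_flow_line V C"
  shows "tangent_to V C"
  unfolding tangent_to_def
proof
  obtain \<phi> where \<phi>: "flow_line V \<phi>" "range \<phi> = C"
    using assms unfolding closed_flow_line_def by blast
  fix p assume "p \<in> C"
  then obtain s where s: "p = \<phi> s" using \<phi>(2) by blast
  have "((\<lambda>u. \<phi> (s + u)) has_vector_derivative V p) (at 0)"
  proof -
    have "((\<lambda>u. s + u) has_vector_derivative 1) (at 0)"
      by (auto intro!: derivative_eq_intros)
    from vector_diff_chain_at[OF this, of \<phi> "V (\<phi> s)"] show ?thesis
      using \<phi>(1) by (simp add: flow_line_def s o_def)
  qed
  then show "\<exists>c. (\<forall>s. c s \<in> C) \<and> c 0 = p \<and> (c has_vector_derivative V p) (at 0)"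
    using \<phi>(2) s by (intro exI[of _ "\<lambda>u. \<phi> (s + u)"]) auto
qed


section \<open>Incompressible fields with a stream function\<close>

text \<open>In every horizontal plane this is the gradient of \<open>f\<close> rotated by a right angle: the planar field
  with stream function \<open>f\<close>, at each height separately.\<close>

definition stream_field :: "(real ^ 3 \<Rightarrow> real) \<Rightarrow> real ^ 3 \<Rightarrow> real ^ 3" where
  "stream_field f p = dir_deriv (axis 1 1) f p *\<^sub>R axis 2 1 - dir_deriv (axis 2 1) f p *\<^sub>R axis 1 1"

lemma stream_field_nth [simp]:
  "stream_field f p $ 1 = - dir_deriv (axis 2 1) f p"
  "stream_field f p $ 2 = dir_deriv (axis 1 1) f p"
  "stream_field f p $ 3 = 0"
  by (simp_all add: stream_field_def axis_def)

lemma divergence_eq_sum_dir_deriv: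
  "divergence V p = (\<Sum>i\<in>UNIV. dir_deriv (axis i 1) (\<lambda>q. V q $ i) p)"
  by (simp add: divergence_def dir_deriv_def)

text \<open>The divergence is the difference of the two mixed second derivatives of \<open>f\<close>, which agree.\<close>

lemma divergence_stream_field:
  assumes "polynomial_family X f"
  shows "divergence (stream_field (f x)) p = 0"
proof -
  have "(\<lambda>s. dir_deriv (axis 2 1) (f x) (p + s *\<^sub>R axis 1 1)) field_differentiable at 0"
    by (rule polynomial_family_differentiable[OF polynomial_family_dir_deriv[OF assms]])
  then have "dir_deriv (axis 1 1) (\<lambda>q. - dir_deriv (axis 2 1) (f x) q) p =
      - dir_deriv (axis 1 1) (dir_deriv (axis 2 1) (f x)) p"
    unfolding dir_deriv_def[of "axis 1 1"] by (rule deriv_minus)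
  then show ?thesis
    using dir_deriv_commute[OF assms]
    by (simp add: divergence_eq_sum_dir_deriv sum_3)
qed

lemma real_analytic_stream_field:
  assumes "polynomial_family X f"
  shows "real_analytic (stream_field (f x))"
  unfolding real_analytic_def
proof
  fix p
  note D = polynomial_family_real_analytic_at[OF polynomial_family_dir_deriv[OF assms]]
  have "stream_field (f x) =
      (\<lambda>p. dir_deriv (axis 1 1) (f x) p *\<^sub>R axis 2 1 + dir_deriv (axis 2 1) (f x) p *\<^sub>R - axis 1 1)"
    by (simp add: fun_eq_iff stream_field_def)
  then show "real_analytic_at (stream_field (f x)) p"
    by (simp only: real_analytic_at_add real_analytic_at_scaleR D)
qed

lemma continuous_map_stream_field:
  assumes "polynomial_family X f"
  shows "continuous_map (prod_topology X euclidean) euclidean (\<lambda>(x, p). stream_field (f x) p)"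
proof -
  have "continuous_map (prod_topology X euclidean) euclidean
      (\<lambda>z. dir_deriv v (f (fst z)) (snd z) *\<^sub>R (b :: real ^ 3))" for v b
  proof -
    have "continuous_map euclideanreal euclidean (\<lambda>r. r *\<^sub>R b)"
      by (simp add: continuous_intros)
    from continuous_map_compose[OF polynomial_family_continuous[OF polynomial_family_dir_deriv[OF assms, of v]] this]
    show ?thesis by (simp add: o_def case_prod_unfold)
  qed
  then show ?thesis
    unfolding stream_field_def case_prod_unfold by (intro continuous_map_diff)
qed


section \<open>The stream function of a configuration of circles\<close>

definition cylinder_equation :: "(real ^ 3) \<times> real \<Rightarrow> real ^ 3 \<Rightarrow> real" where
  "cylinder_equation = (\<lambda>(a, r) p. (p $ 1 - a $ 1)\<^sup>2 + (p $ 2 - a $ 2)\<^sup>2 - r\<^sup>2)"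

text \<open>For a positive radius the circle is the zero set of this function; being a sum of squares, it vanishes
  there together with its derivative.\<close>

definition circle_equation :: "(real ^ 3) \<times> real \<Rightarrow> real ^ 3 \<Rightarrow> real" where
  "circle_equation k p = (cylinder_equation k p)\<^sup>2 + (p $ 3 - fst k $ 3)\<^sup>2"

text \<open>Twice the rotation about the axis of a single circle \<open>k\<close> has the quadratic stream function
  \<open>cylinder_equation k\<close>. The factors \<open>circle_equation j\<close> make the summand of \<open>k\<close> vanish to second
  order on all the other circles, so that the rotations do not disturb each other.\<close>

definition stream_function :: "((real ^ 3) \<times> real) set \<Rightarrow> real ^ 3 \<Rightarrow> real" where
  "stream_function K p = (\<Sum>k\<in>K. cylinder_equation k p * (\<Prod>j\<in>K - {k}. circle_equation j p))"

lemma polynomial_family_cylinder_equation: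
  assumes k: "continuous_map X euclidean k"
  shows "polynomial_family X (\<lambda>x. cylinder_equation (k x))"
proof -
  have *: "continuous_map X euclideanreal (\<lambda>x. g (k x))" if "continuous_on UNIV g"
    for g :: "(real ^ 3) \<times> real \<Rightarrow> real"
    using continuous_map_compose[OF k, of euclidean g] that by (simp add: o_def)
  show ?thesis
    unfolding cylinder_equation_def case_prod_unfold
    by (intro polynomial_family_diff polynomial_family.add polynomial_family_power
        polynomial_family_coordinate polynomial_family.coefficient *[of "\<lambda>k. fst k $ _"] * continuous_intros)
qed

lemma polynomial_family_circle_equation:
  assumes k: "continuous_map X euclidean k"
  shows "polynomial_family X (\<lambda>x. circle_equation (k x))"
proof -
  have "continuous_map X euclideanreal (\<lambda>x. fst (k x) $ 3)"
    using continuous_map_compose[OF k, of euclidean "\<lambda>k. fst k $ 3"]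
    by (simp add: o_def continuous_intros)
  then show ?thesis
    unfolding circle_equation_def
    by (intro polynomial_family_diff polynomial_family.add polynomial_family_power
        polynomial_family_coordinate polynomial_family.coefficient polynomial_family_cylinder_equation k)
qed

lemma polynomial_family_stream_function_const: "polynomial_family X (\<lambda>x. stream_function K)"
  unfolding stream_function_def
  by (intro polynomial_family_sum polynomial_family_mult polynomial_family_prod
      polynomial_family_cylinder_equation polynomial_family_circle_equation) simp_all

lemma dir_deriv_cylinder_equation:
  "dir_deriv v (cylinder_equation (a, r)) p = 2 * (p $ 1 - a $ 1) * v $ 1 + 2 * (p $ 2 - a $ 2) * v $ 2"
  unfolding dir_deriv_def cylinder_equation_def
  by (rule DERIV_imp_deriv) (auto intro!: derivative_eq_intros simp: algebra_simps)

lemma cylinder_equation_eq_0: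
  assumes "r > 0" "p \<in> circle (a, r)"
  shows "cylinder_equation (a, r) p = 0"
  using assms by (auto simp: cylinder_equation_def mem_circle_iff)

lemma circle_equation_pos:
  assumes "r > 0" "p \<notin> circle (a, r)"
  shows "circle_equation (a, r) p > 0"
  using assms
  by (auto simp: circle_equation_def cylinder_equation_def mem_circle_iff sum_power2_gt_zero_iff)

lemma circle_equation_eq_0:
  assumes "r > 0" "p \<in> circle (a, r)"
  shows "circle_equation (a, r) p = 0"
  using assms cylinder_equation_eq_0[OF assms] by (simp add: circle_equation_def mem_circle_iff)

lemma dir_deriv_circle_equation_eq_0:
  assumes "r > 0" "p \<in> circle (a, r)"
  shows "dir_deriv v (circle_equation (a, r)) p = 0"
proof -
  have d: "((\<lambda>s. cylinder_equation (a, r) (p + s *\<^sub>R v)) has_real_derivative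
      dir_deriv v (cylinder_equation (a, r)) p) (at 0)"
    unfolding dir_deriv_cylinder_equation unfolding cylinder_equation_def
    by (auto intro!: derivative_eq_intros simp: algebra_simps)
  show ?thesis
    unfolding dir_deriv_def circle_equation_def
    using cylinder_equation_eq_0[OF assms] assms
    by (intro DERIV_imp_deriv) (auto intro!: derivative_eq_intros d simp: mem_circle_iff)
qed

text \<open>On a circle only its own summand contributes to the derivative: each other summand contains the
  factor \<open>circle_equation (a, r)\<close>, which vanishes there together with its derivative. In the own
  summand, \<open>cylinder_equation (a, r)\<close> vanishes, so only its derivative survives.\<close>

lemma dir_deriv_stream_function_on_circle:
  assumes "finite K" "(a, r) \<in> K" "r > 0" "p \<in> circle (a, r)"
  shows "dir_deriv v (stream_function K) p =
    dir_deriv v (cylinder_equation (a, r)) p * (\<Prod>j\<in>K - {(a, r)}. circle_equation j p)"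
proof -
  let ?k = "(a, r)"
  let ?P = "\<lambda>p. \<Prod>j\<in>K - {?k}. circle_equation j p"
  let ?R = "\<lambda>p. \<Sum>i\<in>K - {?k}. cylinder_equation i p * (\<Prod>j\<in>K - {i} - {?k}. circle_equation j p)"
  have "stream_function K q = cylinder_equation ?k q * ?P q + circle_equation ?k q * ?R q" for q
  proof -
    have "(\<Prod>j\<in>K - {i}. circle_equation j q) =
        circle_equation ?k q * (\<Prod>j\<in>K - {i} - {?k}. circle_equation j q)" if "i \<in> K - {?k}" for i
      using assms that by (intro prod.remove) auto
    then show ?thesis
      unfolding stream_function_def sum.remove[OF assms(1,2)]
      by (simp add: sum_distrib_left mult.left_commute)
  qed
  then have split: "stream_function K =
      (\<lambda>q. cylinder_equation ?k q * ?P q + circle_equation ?k q * ?R q)" by blast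
  note poly = polynomial_family_mult polynomial_family_sum polynomial_family_prod
    polynomial_family_cylinder_equation polynomial_family_circle_equation
  \<comment> \<open>A polynomial is a family that is constant in its parameter, here a dummy real parameter.\<close>
  define X where "X = (euclidean :: real topology)"
  have F: "polynomial_family X (\<lambda>x. cylinder_equation ?k)"
    and G: "polynomial_family X (\<lambda>x. circle_equation ?k)"
    and P: "polynomial_family X (\<lambda>x. ?P)" and R: "polynomial_family X (\<lambda>x. ?R)"
    by (intro poly; simp)+
  note diff = polynomial_family_differentiable
  show ?thesis
    unfolding split
    by (simp only: dir_deriv_add[OF diff[OF polynomial_family_mult[OF F P]] diff[OF polynomial_family_mult[OF G R]]]
        dir_deriv_mult[OF diff[OF F] diff[OF P]] dir_deriv_mult[OF diff[OF G] diff[OF R]])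
      (simp add: assms cylinder_equation_eq_0 circle_equation_eq_0 dir_deriv_circle_equation_eq_0)
qed

text \<open>Along \<open>k\<close> the field is the rotation about the axis of \<open>k\<close> times twice the product of the other
  circles' equations. These are positive there because the circles are disjoint; so the field does
  not stop, and the whole circle is one orbit.\<close>

lemma closed_flow_line_stream_field:
  assumes K: "finite K" "\<And>k. k \<in> K \<Longrightarrow> snd k > 0" "disjoint_family_on circle K" and "k \<in> K"
  shows "closed_flow_line (stream_field (stream_function K)) (circle k)"
proof -
  obtain a r where k: "k = (a, r)" by fastforce
  with K \<open>k \<in> K\<close> have r: "r > 0" by fastforce
  let ?P = "\<lambda>p. \<Prod>j\<in>K - {k}. circle_equation j p"
  show ?thesis
    unfolding k
  proof (rule closed_flow_line_circle[OF r, of _ "\<lambda>p. 2 * ?P p"])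
    \<comment> \<open>Restricting the continuity of a family in \<open>(x, p)\<close> to \<open>x = 0\<close> gives continuity in \<open>p\<close>.\<close>
    have "continuous_map (prod_topology euclideanreal euclidean) euclideanreal (\<lambda>(x, p). 2 * ?P p)"
      by (intro polynomial_family_continuous polynomial_family_mult polynomial_family_const
          polynomial_family_prod polynomial_family_circle_equation) simp
    then have "continuous_on UNIV (\<lambda>z :: real \<times> (real ^ 3). 2 * ?P (snd z))"
      by (simp add: case_prod_unfold)
    from continuous_on_compose2[OF this, of _ "\<lambda>p. (0, p)"]
    show "continuous_on (circle (a, r)) (\<lambda>p. 2 * ?P p)"
      by (simp add: continuous_intros)
    fix p assume p: "p \<in> circle (a, r)"
    have "circle_equation j p > 0" if "j \<in> K - {k}" for j
    proof -
      have "circle j \<inter> circle k = {}"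
        using K(3) \<open>k \<in> K\<close> that by (auto simp: disjoint_family_on_def)
      with p k K(2)[of j] that circle_equation_pos[of "snd j" p "fst j"] show ?thesis by auto
    qed
    then show "2 * ?P p > 0" by (intro mult_pos_pos prod_pos) auto
    show "stream_field (stream_function K) p = (2 * ?P p) *\<^sub>R vector [- (p $ 2 - a $ 2), p $ 1 - a $ 1, 0]"
      using \<open>k \<in> K\<close> p r K(1)
      by (simp add: vec_eq_iff forall_3 k dir_deriv_stream_function_on_circle
          dir_deriv_cylinder_equation axis_def algebra_simps)
  qed
qed

section \<open>Components and tangency\<close>

text \<open>Being finitely many, closed and disjoint, the circles are open and closed in their union, and each
  is connected.\<close>

lemma component_Union_circles:
  assumes K: "finite K" "\<And>k. k \<in> K \<Longrightarrow> snd k > 0" "disjoint_family_on circle K"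
    and C: "C \<in> components (\<Union>k\<in>K. circle k)"
  obtains k where "k \<in> K" "C = circle k"
proof -
  have C': "C \<noteq> {}" "C \<subseteq> (\<Union>k\<in>K. circle k)" "connected C"
    using C in_components_nonempty in_components_subset in_components_connected by blast+
  then obtain k p where k: "k \<in> K" "p \<in> circle k" "p \<in> C" by blast
  have "connected (circle k)"
    using connected_circle[of "snd k" "fst k"] K(2)[OF k(1)] by simp
  then have "circle k \<subseteq> C"
    using components_maximal[OF C] k by blast
  moreover have "C \<subseteq> circle k"
  proof (rule ccontr)
    let ?S = "\<Union>j\<in>K - {k}. circle j"
    assume "\<not> C \<subseteq> circle k"
    then have "?S \<inter> C \<noteq> {}" using C'(2) by blast
    moreover have "circle k \<inter> C \<noteq> {}" using k by blast
    moreover have "C \<subseteq> circle k \<union> ?S" using C'(2) by blast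
    moreover have "closed ?S" using K(1) closed_circle by blast
    moreover have "circle k \<inter> ?S \<inter> C = {}"
      using K(3) k(1) by (auto simp: disjoint_family_on_def)
    ultimately show False
      using connected_closedD[OF C'(3), of "circle k" ?S] closed_circle[of k] by simp
  qed
  ultimately show ?thesis using that k(1) by blast
qed

lemma tangent_to_Union:
  assumes "\<And>S. S \<in> \<S> \<Longrightarrow> tangent_to V S"
  shows "tangent_to V (\<Union>\<S>)"
  using assms unfolding tangent_to_def by (meson UnionE UnionI)

section \<open>Continuity on the configuration space\<close>

text \<open>The two pairs of opposite points at the angles \<open>0, \<pi>\<close> and \<open>\<pi> / 2, - \<pi> / 2\<close> determine the centre.\<close>

lemma circle_inject:
  assumes "r > 0" "r' > 0" "circle (a, r) = circle (a', r')"
  shows "a = a'" "r = r'"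
proof -
  have "circle_point (a, r) \<theta> \<in> circle (a', r')" for \<theta>
    using range_circle_point[OF assms(1)] assms(3) by blast
  then have *: "a $ 3 = a' $ 3" "(a $ 1 + r * cos \<theta> - a' $ 1)\<^sup>2 + (a $ 2 + r * sin \<theta> - a' $ 2)\<^sup>2 = r'\<^sup>2" for \<theta>
    using assms(2) by (simp_all add: mem_circle_iff)
  have "(a $ 1 + r - a' $ 1)\<^sup>2 = (a $ 1 - r - a' $ 1)\<^sup>2"
    using *(2)[of 0] *(2)[of pi] by simp
  then have 1: "a $ 1 = a' $ 1"
    using assms(1) by (simp add: power2_eq_square algebra_simps)
  have "(a $ 2 + r - a' $ 2)\<^sup>2 = (a $ 2 - r - a' $ 2)\<^sup>2"
    using *(2)[of "pi / 2"] *(2)[of "- (pi / 2)"] by simp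
  then have 2: "a $ 2 = a' $ 2"
    using assms(1) by (simp add: power2_eq_square algebra_simps)
  show "a = a'" using 1 2 *(1) by (simp add: vec_eq_iff forall_3)
  show "r = r'" using *(2)[of 0] 1 2 assms(1,2) by (simp add: power2_eq_iff_nonneg)
qed

text \<open>A circle of positive radius determines its centre and radius, whereas every negative radius gives
  the empty set.\<close>

definition circles_of :: "(real ^ 3) set set \<Rightarrow> ((real ^ 3) \<times> real) set" where
  "circles_of L = {k. 0 < snd k \<and> circle k \<in> L}"

lemma ordered_configsD:
  assumes "c \<in> ordered_configs n D"
  shows "inj_on c {..<n}" "circles_of (forget_order n c) = c ` {..<n}"
    "disjoint_family_on circle (c ` {..<n})" "\<And>i. i < n \<Longrightarrow> 0 < snd (c i)"
proof -
  show pos: "0 < snd (c i)" if "i < n" for i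
    using assms that by (simp add: ordered_configs_def)
  have disj: "circle (c i) \<inter> circle (c j) = {}" if "i < n" "j < n" "i \<noteq> j" for i j
    using assms that by (auto simp: ordered_configs_def disjoint_family_on_def)
  have "circle (c i) \<noteq> {}" if "i < n" for i
    using range_circle_point[of "snd (c i)" "fst (c i)"] pos[OF that] by auto
  then show "inj_on c {..<n}"
    using disj by (metis Int_absorb inj_onI lessThan_iff)
  show "circles_of (forget_order n c) = c ` {..<n}"
  proof
    show "c ` {..<n} \<subseteq> circles_of (forget_order n c)"
      using pos by (auto simp: circles_of_def forget_order_def)
    show "circles_of (forget_order n c) \<subseteq> c ` {..<n}"
    proof
      fix k assume "k \<in> circles_of (forget_order n c)"
      then obtain i where i: "0 < snd k" "i < n" "circle k = circle (c i)"
        unfolding circles_of_def forget_order_def by blast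
      have "fst k = fst (c i) \<and> snd k = snd (c i)"
        using circle_inject[OF i(1) pos[OF i(2)], of "fst k" "fst (c i)"] i(3)
        unfolding prod.collapse by blast
      then show "k \<in> c ` {..<n}" using i(2) by (simp add: prod_eq_iff image_iff) blast
    qed
  qed
  show "disjoint_family_on circle (c ` {..<n})"
    using disj by (auto simp: disjoint_family_on_def)
qed

lemma topspace_ordered_config_space: "topspace (ordered_config_space n D) = ordered_configs n D"
  by (auto simp: ordered_config_space_def ordered_configs_def PiE_def)

text \<open>On ordered configurations the stream function is a polynomial family, hence its field is continuous
  in the configuration and the point jointly. It is symmetric in the circles and so descends to the
  quotient by reordering. That the descended map is still jointly continuous rests on the local
  compactness of the space of points, by which the quotient map times the identity of that space is
  again a quotient map.\<close>

lemma continuous_map_config_space_field: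
  "continuous_map (prod_topology (config_space n D) euclidean) euclidean
    (\<lambda>(L, p). stream_field (stream_function (circles_of L)) p)"
proof -
  let ?X = "ordered_config_space n D"
  define f where "f = (\<lambda>c :: nat \<Rightarrow> (real ^ 3) \<times> real. \<lambda>p.
    \<Sum>i<n. cylinder_equation (c i) p * (\<Prod>j\<in>{..<n} - {i}. circle_equation (c j) p))"
  have proj: "continuous_map ?X euclidean (\<lambda>c. c i)" if "i < n" for i
    unfolding ordered_config_space_def
    using that by (intro continuous_map_from_subtopology continuous_map_product_projection) simp
  have "polynomial_family ?X f"
    unfolding f_def
    by (intro polynomial_family_sum polynomial_family_mult polynomial_family_prod
        polynomial_family_cylinder_equation polynomial_family_circle_equation proj) auto
  then have "continuous_map (prod_topology ?X euclidean) euclidean (\<lambda>(c, p). stream_field (f c) p)"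
    by (rule continuous_map_stream_field)
  moreover have "f c = stream_function (circles_of (forget_order n c))" if "c \<in> topspace ?X" for c
  proof -
    note c = ordered_configsD[OF that[unfolded topspace_ordered_config_space]]
    have "c ` {..<n} - {c i} = c ` ({..<n} - {i})" if "i < n" for i
      using c(1) that by (auto simp: inj_on_def)
    moreover have "inj_on c ({..<n} - {i})" for i
      using c(1) by (rule inj_on_subset) auto
    ultimately show ?thesis
      by (simp add: f_def fun_eq_iff stream_function_def c(2) sum.reindex[OF c(1)] prod.reindex)
  qed
  ultimately have "continuous_map (prod_topology ?X euclidean) euclidean
      ((\<lambda>(L, p). stream_field (stream_function (circles_of L)) p) \<circ> (\<lambda>(c, p). (forget_order n c, p)))"
    by (elim continuous_map_eq) auto
  moreover have "quotient_map (prod_topology ?X euclidean) (prod_topology (config_space n D) euclidean)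
      (\<lambda>(c, p). (forget_order n c, p :: real ^ 3))"
    unfolding config_space_def
    by (intro quotient_map_prod_left quotient_map_quotient_topology locally_compact_space_euclidean)
      (simp)
  ultimately show ?thesis
    by (rule continuous_compose_quotient_map[rotated])
qed

section \<open>Loop braids\<close>

text \<open>The map is continuous on each closed strip \<open>[m c, (m + 1) c] \<times> UNIV\<close>, on whose right-hand edge the
  representative in \<open>{0..<c}\<close> jumps from \<open>c\<close> to \<open>0\<close> without changing \<open>f\<close>. Every point is interior to
  a union of two adjacent strips.\<close>

lemma continuous_on_periodic_extension:
  fixes f :: "real \<Rightarrow> 'a::t2_space \<Rightarrow> 'b::topological_space"
  assumes "c > 0" and cont: "continuous_on ({0..c} \<times> UNIV) (\<lambda>(t, p). f t p)" and per: "f 0 = f c"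
  shows "continuous_on UNIV (\<lambda>(t, p). f (t rmod c) p)"
proof -
  have strip: "continuous_on ({of_int m * c..of_int (m + 1) * c} \<times> UNIV) (\<lambda>(t, p). f (t rmod c) p)"
    for m :: int
  proof -
    have "continuous_on ({of_int m * c..of_int (m + 1) * c} \<times> UNIV)
        (\<lambda>z. (\<lambda>(t, p). f t p) (fst z - of_int m * c, snd z))"
      by (intro continuous_on_compose2[OF cont] continuous_intros) (auto simp: algebra_simps)
    moreover have "f (t rmod c) = f (t - of_int m * c)" if "t \<in> {of_int m * c..of_int (m + 1) * c}" for t
    proof (cases "t = of_int (m + 1) * c")
      case True
      then have "t rmod c = 0" "t - of_int m * c = c"
        by (simp only: rmod_self_multiple_int) (simp add: True algebra_simps)
      then show ?thesis by (simp add: per)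
    next
      case False
      then have "t rmod c = t - of_int m * c"
        using that \<open>c > 0\<close> by (intro rmod_unique) (auto simp: algebra_simps)
      then show ?thesis by simp
    qed
    ultimately show ?thesis
      by (elim continuous_on_eq) auto
  qed
  have "isCont (\<lambda>(t, p). f (t rmod c) p) (t, p)" for t p
  proof -
    define m where "m = \<lfloor>t / c\<rfloor>"
    let ?U = "{of_int (m - 1) * c<..<of_int (m + 1) * c} \<times> (UNIV :: 'a set)"
    have "of_int m \<le> t / c" "t / c < of_int m + 1"
      by (auto simp: m_def)
    then have t: "of_int m * c \<le> t" "t < of_int (m + 1) * c"
      using \<open>c > 0\<close> by (auto simp: field_simps)
    have "closed ({of_int m * c..of_int (m + 1) * c} \<times> (UNIV :: 'a set))" for m
      by (intro closed_Times) auto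
    then have "continuous_on ({of_int (m - 1) * c..of_int (m - 1 + 1) * c} \<times> UNIV \<union>
        {of_int m * c..of_int (m + 1) * c} \<times> UNIV) (\<lambda>(t, p). f (t rmod c) p)"
      by (intro continuous_on_closed_Un strip)
    then have "continuous_on ?U (\<lambda>(t, p). f (t rmod c) p)"
      by (rule continuous_on_subset) auto
    moreover have "open ?U" by (intro open_Times) auto
    moreover have "(t, p) \<in> ?U" using t \<open>c > 0\<close> by (auto simp: algebra_simps)
    ultimately show ?thesis
      using continuous_on_eq_continuous_at by blast
  qed
  then show ?thesis
    by (auto intro!: continuous_at_imp_continuous_on)
qed

theorem proposition1p3:
  fixes n :: nat and B :: "((real ^ 3) \<times> real) set"
  assumes "loop_braid n B"
  shows "\<exists>V :: real \<Rightarrow> real ^ 3 \<Rightarrow> real ^ 3.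
    continuous_on UNIV (\<lambda>(t, p). V t p) \<and>
    (\<forall>t. real_analytic (V t)) \<and>
    (\<forall>t p. divergence (V t) p = 0) \<and>
    (\<forall>t. V t = V (t + 2 * pi)) \<and>
    (\<forall>t. \<forall>C \<in> components (slice B (t rmod (2 * pi))). closed_flow_line (V t) C) \<and>
    (\<forall>t. tangent_to (V t) (slice B (t rmod (2 * pi))))"
proof -
  obtain a R \<gamma> where
    \<gamma>: "continuous_map (top_of_set {0..2 * pi}) (config_space n (cball a R)) \<gamma>" "\<gamma> 0 = \<gamma> (2 * pi)"
    and B: "B = {(p, t). t \<in> {0..2 * pi} \<and> p \<in> \<Union>(\<gamma> t)}"
    using assms unfolding loop_braid_def by blast
  define W where "W t = stream_field (stream_function (circles_of (\<gamma> t)))" for t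
  define V where "V t = W (t rmod (2 * pi))" for t
  have poly: "polynomial_family euclideanreal (\<lambda>x. stream_function K)" for K
    by (rule polynomial_family_stream_function_const)
  have "continuous_map (prod_topology (top_of_set {0..2 * pi}) euclidean)
      (prod_topology (config_space n (cball a R)) euclidean) (\<lambda>(t, p :: real ^ 3). (\<gamma> t, p))"
    using \<gamma>(1) by (simp add: continuous_map_prod_top[of _ _ _ _ \<gamma> "\<lambda>p. p", simplified])
  from continuous_map_compose[OF this continuous_map_config_space_field]
  have "continuous_map (top_of_set ({0..2 * pi} \<times> UNIV)) euclidean (\<lambda>(t, p). W t p)"
    by (simp add: W_def o_def case_prod_unfold prod_topology_subtopology_eu[of _ UNIV, simplified])
  then have "continuous_on ({0..2 * pi} \<times> UNIV) (\<lambda>(t, p). W t p)"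
    by simp
  then have cont: "continuous_on UNIV (\<lambda>(t, p). V t p)"
    unfolding V_def by (rule continuous_on_periodic_extension[rotated]) (simp_all add: W_def \<gamma>(2))
  have V_circles: "(\<forall>C\<in>components (slice B (t rmod (2 * pi))). closed_flow_line (V t) C) \<and>
    tangent_to (V t) (slice B (t rmod (2 * pi)))" for t
  proof -
    let ?\<tau> = "t rmod (2 * pi)"
    have \<tau>: "?\<tau> \<in> {0..2 * pi}"
      by (simp add: rmod_le rmod_nonneg)
    then have "\<gamma> ?\<tau> \<in> topspace (config_space n (cball a R))"
      using \<gamma>(1) by (auto simp: continuous_map_def)
    then obtain c where c: "c \<in> ordered_configs n (cball a R)" "\<gamma> ?\<tau> = forget_order n c"
      by (auto simp: config_space_def topspace_quotient_topology topspace_ordered_config_space)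
    note c' = ordered_configsD[OF c(1)]
    let ?K = "c ` {..<n}"
    have V: "V t = stream_field (stream_function ?K)"
      by (simp add: V_def W_def c(2) c'(2))
    have slice: "slice B ?\<tau> = (\<Union>k\<in>?K. circle k)"
      using \<tau> by (auto simp: slice_def B c(2) forget_order_def)
    have K: "finite ?K" "\<And>k. k \<in> ?K \<Longrightarrow> snd k > 0" "disjoint_family_on circle ?K"
      using c'(3,4) by auto
    note flow = closed_flow_line_stream_field[OF K]
    have "closed_flow_line (V t) C" if "C \<in> components (slice B ?\<tau>)" for C
      using component_Union_circles[OF K that[unfolded slice]] flow unfolding V by metis
    moreover have "tangent_to (V t) (slice B ?\<tau>)"
      unfolding V slice using closed_flow_line_imp_tangent_to[OF flow]
      by (intro tangent_to_Union) blast
    ultimately show ?thesis by blast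
  qed
  have "(t + 2 * pi) rmod (2 * pi) = t rmod (2 * pi)" for t
    using rmod_add[of t "2 * pi" "2 * pi"] by simp
  then have "V t = V (t + 2 * pi)" for t
    by (simp add: V_def)
  moreover have "real_analytic (V t)" "divergence (V t) p = 0" for t p
    unfolding V_def W_def
    by (rule real_analytic_stream_field[OF poly] divergence_stream_field[OF poly])+
  ultimately show ?thesis
    using cont V_circles by (intro exI[of _ V]) blast
qed

end
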